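(* Let $n\ge5$ be an odd integer and let $$L=\begin{bmatrix}\frac{n-1}{2} & -\frac12\mathbf{e}' & \mathbf{0}'\\ -\frac12\mathbf{e} & A & B\\ \mathbf{0} & B & I_{n-1}\end{bmatrix},$$ where $A=\mathrm{Circ}(\mathbf{x}')$ and $B=\mathrm{Circ}(\mathbf{y}')$ are the circulant matrices of order $n-1$ defined in the context. Then $L$ is a positive semidefinite matrix.
   Context: A prime denotes transpose; $\mathbf{e},\mathbf{0}\in\mathbb{R}^{n-1}$ are the all-ones and zero column vectors; $I_{n-1}$ is the identity matrix of order $n-1$. A real symmetric matrix $M$ is positive semidefinite if $\mathbf{z}'M\mathbf{z}\ge0$ for all real $\mathbf{z}$. For $\mathbf{a}=(a_1,\dots,a_N)'\in\mathbb{R}^N$, $\mathrm{Circ}(\mathbf{a}')$ is the $N\times N$ circulant matrix with first row $(a_1,a_2,\dots,a_N)$, each subsequent row being the previous row cyclically shifted one place to the right. Vectors $\mathbf{x},\mathbf{y}$ (for odd $n\ge5$): put $m=\frac{n-1}{2}$ and, for $1\le k\le m$, $\alpha_k=(-1)^{k+1}\left[2m^2-6(m-k)^2+7\right]$. Then $$\mathbf{x}=\frac{1}{6(n-1)}(n^2+4n-12,\alpha_1,\alpha_2,\dots,\alpha_{m-1},\alpha_m,\alpha_{m-1},\dots,\alpha_2,\alpha_1)'\in\mathbb{R}^{n-1},$$ $$\mathbf{y}=\frac{1}{n-1}(2-n,-1,1,-1,1,\dots,-1,1,-1)'\in\mathbb{R}^{n-1}.$$ (With these vectors $A$ and $B$,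 hence $L$, are symmetric.) *)

theory Defs
  imports Complex_Main "Jordan_Normal_Form.Matrix"
begin

text \<open>Vectors and matrices are indexed from 0. The condition \<open>transpose_mat M = M\<close> also forces
  \<open>M\<close> to be square.\<close>

definition pos_semidef :: "real mat \<Rightarrow> bool" where
  "pos_semidef M \<longleftrightarrow>
     transpose_mat M = M \<and> (\<forall>z \<in> carrier_vec (dim_row M). 0 \<le> z \<bullet> (M *\<^sub>v z))"

text \<open>Row \<open>i\<close> is \<open>a\<close> cyclically shifted \<open>i\<close> places to the right; the entry is
  \<open>a\<close> at \<open>j - i\<close> modulo the length, with the length added first because
  subtraction on \<open>nat\<close> truncates.\<close>

definition circ :: "'a vec \<Rightarrow> 'a mat" where
  "circ a = (let N = dim_vec a in mat N N (\<lambda>(i, j). a $ ((j + N - i) mod N)))"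

definition alpha :: "nat \<Rightarrow> nat \<Rightarrow> real" where
  "alpha m k = (-1) ^ (k + 1) * (2 * (real m)\<^sup>2 - 6 * (real m - real k)\<^sup>2 + 7)"

definition x_vec :: "nat \<Rightarrow> real vec" where
  "x_vec n = (let m = (n - 1) div 2 in
     (1 / (6 * (real n - 1))) \<cdot>\<^sub>v
       vec_of_list (((real n)\<^sup>2 + 4 * real n - 12) #
         map (alpha m) [1..<m] @ [alpha m m] @ rev (map (alpha m) [1..<m])))"

definition y_vec :: "nat \<Rightarrow> real vec" where
  "y_vec n = (1 / (real n - 1)) \<cdot>\<^sub>v
     vec (n - 1) (\<lambda>j. if j = 0 then 2 - real n else (-1) ^ j)"

text \<open>The 3-by-3 block matrix \<open>L\<close>, grouped so that the scalar corner is one block and the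
  remaining 2-by-2 array of blocks of order \<open>n - 1\<close> is another. The vector \<open>v\<close> stacks
  \<open>-e/2\<close> on top of the zero vector.\<close>

definition L_mat :: "nat \<Rightarrow> real mat" where
  "L_mat n =
     (let A = circ (x_vec n);
          B = circ (y_vec n);
          e = vec (n - 1) (\<lambda>_. 1);
          v = ((- 1 / 2) \<cdot>\<^sub>v e) @\<^sub>v 0\<^sub>v (n - 1)
      in four_block_mat
           (mat 1 1 (\<lambda>_. (real n - 1) / 2)) (mat_of_rows (dim_vec v) [v])
           (mat_of_cols (dim_vec v) [v])     (four_block_mat A B B (1\<^sub>m (n - 1))))"

end

theory Submission
  imports Defs
begin

text \<open>Put \<open>n - 1 = 2 m\<close>. Completing squares in the quadratic form of \<open>L\<close> at \<open>(t, u, w)\<close> leaves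
  \<open>|w + B u|\<^sup>2 + m (t - e'u / (2 m))\<^sup>2 + u' C u\<close> with \<open>C = A - B\<^sup>2 - e e' / (4 m)\<close>. Here
  \<open>B = s s' / (2 m) - I\<close> for the alternating vector \<open>s\<close>, so \<open>B\<^sup>2 = - B\<close>. After conjugation by
  the signs \<open>s\<close>, the entries of \<open>C\<close> are quadratic in the cyclic distance up to an alternating term,
  and such a matrix is, up to a factor, the Gram matrix of the cyclic shifts of a sawtooth that is
  orthogonal to the constant and to the alternating vector.\<close>

section \<open>Gram matrices and closure of positive semidefiniteness\<close>

definition gram_mat :: "'k set \<Rightarrow> nat \<Rightarrow> ('k \<Rightarrow> nat \<Rightarrow> real) \<Rightarrow> real mat" where
  "gram_mat K d r = mat d d (\<lambda>(i, j). \<Sum>k\<in>K. r k i * r k j)"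

lemma gram_mat_carrier: "gram_mat K d r \<in> carrier_mat d d"
  by (simp add: gram_mat_def)

text \<open>The quadratic form at \<open>z\<close> is the sum over \<open>k\<close> in
  \<open>K\<close> of the squares of the linear forms with coefficient rows
  \<open>r k\<close>.\<close>

lemma pos_semidef_gram_mat: "pos_semidef (gram_mat K d r)"
  unfolding pos_semidef_def
proof (intro conjI ballI)
  show "transpose_mat (gram_mat K d r) = gram_mat K d r"
    by (rule eq_matI) (auto simp: gram_mat_def mult.commute)
  fix z :: "real vec"
  assume "z \<in> carrier_vec (dim_row (gram_mat K d r))"
  then have z: "dim_vec z = d"
    by (simp add: gram_mat_def)
  have "z \<bullet> (gram_mat K d r *\<^sub>v z)
      = (\<Sum>i<d. \<Sum>j<d. \<Sum>k\<in>K. (r k i * z $ i) * (r k j * z $ j))"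
    using z by (simp add: gram_mat_def scalar_prod_def atLeast0LessThan sum_distrib_left
        sum_distrib_right algebra_simps)
  also have "\<dots> = (\<Sum>i<d. \<Sum>k\<in>K. \<Sum>j<d. (r k i * z $ i) * (r k j * z $ j))"
    by (intro sum.cong refl sum.swap)
  also have "\<dots> = (\<Sum>k\<in>K. \<Sum>i<d. \<Sum>j<d. (r k i * z $ i) * (r k j * z $ j))"
    by (rule sum.swap)
  also have "\<dots> = (\<Sum>k\<in>K. (\<Sum>i<d. r k i * z $ i)\<^sup>2)"
    by (simp add: power2_eq_square sum_product)
  also have "\<dots> \<ge> 0"
    by (intro sum_nonneg) simp
  finally show "0 \<le> z \<bullet> (gram_mat K d r *\<^sub>v z)" .
qed

lemma pos_semidef_add:
  assumes "pos_semidef M" "pos_semidef M'" "M \<in> carrier_mat d d" "M' \<in> carrier_mat d d"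
  shows "pos_semidef (M + M')"
  using assms unfolding pos_semidef_def
  by (auto simp: transpose_add add_mult_distrib_mat_vec scalar_prod_add_distrib[where n = d])

lemma pos_semidef_smult:
  assumes "pos_semidef M" "M \<in> carrier_mat d d" "0 \<le> c"
  shows "pos_semidef (c \<cdot>\<^sub>m M)"
proof -
  have "transpose_mat (c \<cdot>\<^sub>m M) = c \<cdot>\<^sub>m transpose_mat M"
    by (rule eq_matI) auto
  moreover have "z \<bullet> ((c \<cdot>\<^sub>m M) *\<^sub>v z) = c * (z \<bullet> (M *\<^sub>v z))"
    if "z \<in> carrier_vec d" for z
    using that assms(2) by (auto simp: scalar_prod_def sum_distrib_left sum_distrib_right mult_ac)
  ultimately show ?thesis
    using assms unfolding pos_semidef_def by auto
qed

section \<open>Correlations of shifted sawtooths\<close>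

lemma sum_lessThan_split:
  fixes f :: "nat \<Rightarrow> real"
  assumes "i \<le> j"
  shows "(\<Sum>k<j. f k) = (\<Sum>k<i. f k) + (\<Sum>k=i..<j. f k)"
  using assms by (metis atLeast0LessThan le0 sum.atLeastLessThan_concat)

text \<open>Closed form of the sum of \<open>(k + a + s * (-1) ^ k) * (k + b + t * (-1) ^ k)\<close>
  over \<open>k < p\<close>, where \<open>e\<close> stands for \<open>(-1) ^ p\<close>. The terms
  come from summing \<open>k^2\<close>, \<open>k\<close>, \<open>1\<close>,
  \<open>k * (-1) ^ k\<close> and \<open>(-1) ^ k\<close> in turn.\<close>

definition affine_alternating_sum :: "real \<Rightarrow> real \<Rightarrow> real \<Rightarrow> real \<Rightarrow> real \<Rightarrow> real \<Rightarrow> real" where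
  "affine_alternating_sum s t a b p e =
    p * (p - 1) * (2 * p - 1) / 6 + (a + b) * (p * (p - 1) / 2)
    + p * (a * b + s * t) + (s + t) * ((e * (1 - 2 * p) - 1) / 4)
    + (a * t + b * s) * ((1 - e) / 2)"

lemma affine_alternating_sum_Suc:
  assumes "e = 1 \<or> e = -1"
  shows "affine_alternating_sum s t a b p e + (p + a + s * e) * (p + b + t * e) =
    affine_alternating_sum s t a b (p + 1) (- e)"
  using assms unfolding affine_alternating_sum_def
  by (elim disjE)
     (simp_all add: algebra_simps power2_eq_square add_divide_distrib diff_divide_distrib)

lemma sum_affine_alternating_product:
  "(\<Sum>k<p. (real k + a + s * (-1) ^ k) * (real k + b + t * (-1) ^ k)) =
    affine_alternating_sum s t a b (real p) ((-1) ^ p)"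
proof (induction p)
  case (Suc p)
  have "(-1) ^ p = (1::real) \<or> (-1) ^ p = (-1::real)"
    by (simp add: minus_one_power_iff)
  note step = affine_alternating_sum_Suc[OF this, of s t a b "real p"]
  have "real p + 1 = real (Suc p)" "- ((-1) ^ p) = (-1 :: real) ^ Suc p"
    by simp_all
  then show ?case
    unfolding sum.lessThan_Suc Suc.IH step by (simp only:)
qed (simp add: affine_alternating_sum_def)

text \<open>Adds the pieces over \<open>[0, i)\<close>, \<open>[i, j)\<close> and
  \<open>[j, 2 m)\<close> of a sawtooth correlation. Here \<open>s\<close> and \<open>t\<close>
  stand for \<open>(-1) ^ i\<close> and \<open>(-1) ^ j\<close>, so they serve both as signs of the
  alternating parts and as end-point signs; at \<open>2 m\<close> that sign is 1.\<close>

lemma affine_alternating_sum_identity: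
  fixes i j m s t :: real
  assumes "s = 1 \<or> s = -1" "t = 1 \<or> t = -1"
  defines "a \<equiv> 1 / 2 - m - i" and "b \<equiv> 1 / 2 - m - j"
    and "T \<equiv> affine_alternating_sum (s / 2) (t / 2)"
  shows "T (a + 2 * m) (b + 2 * m) i s + (T a (b + 2 * m) j t - T a (b + 2 * m) i s)
      + (T a b (2 * m) 1 - T a b j t) =
    m / 6 * (6 * (m - (j - i))\<^sup>2 - 2 * m\<^sup>2 - 1 - 3 * (s * t))"
  using assms(1,2) unfolding T_def a_def b_def affine_alternating_sum_def
  by (elim disjE)
     (simp_all add: algebra_simps power2_eq_square add_divide_distrib diff_divide_distrib)

text \<open>With \<open>r = (k - i) mod 2 m\<close> this is \<open>r - m + 1/2 + (-1) ^ r / 2\<close>.\<close>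

definition sawtooth :: "nat \<Rightarrow> nat \<Rightarrow> nat \<Rightarrow> real" where
  "sawtooth m i k = real k - real i + (if k < i then 2 * real m else 0) - real m + 1 / 2
     + (-1) ^ i * (-1) ^ k / 2"

lemma sawtooth_correlation:
  assumes "i \<le> j" "j < 2 * m"
  shows "(\<Sum>k<2 * m. sawtooth m i k * sawtooth m j k) =
    real m / 6 * (6 * (real m - (real j - real i))\<^sup>2 - 2 * (real m)\<^sup>2 - 1 - 3 * ((-1) ^ i * (-1) ^ j))"
proof -
  define s t :: real where "s = (-1) ^ i" and "t = (-1) ^ j"
  define F where "F a b k = (real k + a + s / 2 * (-1) ^ k) * (real k + b + t / 2 * (-1) ^ k)"
    for a b and k :: nat
  define P where "P a b p = (\<Sum>k<p. F a b k)" for a b and p :: nat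
  \<comment> \<open>Offsets of the two sawtooths after their jumps at \<open>k = i\<close> and
    \<open>k = j\<close>; before its jump each offset is larger by
    \<open>2 * real m\<close>.\<close>
  define a b where "a = 1 / 2 - real m - real i" and "b = 1 / 2 - real m - real j"
  let ?S = "\<lambda>k. sawtooth m i k * sawtooth m j k"
  have P: "P a b q = P a b p + (\<Sum>k=p..<q. F a b k)" if "p \<le> q" for a b p q
    unfolding P_def by (rule sum_lessThan_split[OF that])
  have "(\<Sum>k<2 * m. ?S k) = (\<Sum>k<i. ?S k) + (\<Sum>k=i..<j. ?S k) + (\<Sum>k=j..<2 * m. ?S k)"
    using assms by (simp add: sum_lessThan_split[of i j] sum_lessThan_split[of j "2 * m"])
  also have "(\<Sum>k<i. ?S k) = P (a + 2 * real m) (b + 2 * real m) i"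
    unfolding P_def using assms
    by (intro sum.cong refl) (simp add: F_def sawtooth_def a_def b_def s_def t_def algebra_simps)
  also have "(\<Sum>k=i..<j. ?S k) = (\<Sum>k=i..<j. F a (b + 2 * real m) k)"
    by (intro sum.cong refl) (simp add: F_def sawtooth_def a_def b_def s_def t_def algebra_simps)
  also have "\<dots> = P a (b + 2 * real m) j - P a (b + 2 * real m) i"
    using P[OF assms(1)] by simp
  also have "(\<Sum>k=j..<2 * m. ?S k) = (\<Sum>k=j..<2 * m. F a b k)"
    using assms
    by (intro sum.cong refl) (simp add: F_def sawtooth_def a_def b_def s_def t_def algebra_simps)
  also have "\<dots> = P a b (2 * m) - P a b j"
    using P[of j "2 * m"] assms by simp
  finally have eq: "(\<Sum>k<2 * m. ?S k) = P (a + 2 * real m) (b + 2 * real m) i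
      + (P a (b + 2 * real m) j - P a (b + 2 * real m) i) + (P a b (2 * m) - P a b j)" .
  have "s = 1 \<or> s = -1" "t = 1 \<or> t = -1"
    by (simp_all add: s_def t_def minus_one_power_iff)
  note affine_alternating_sum_identity[OF this, of "real m" "real i" "real j"]
  moreover have "P a b p = affine_alternating_sum (s / 2) (t / 2) a b (real p) ((-1) ^ p)"
    for a b p
    unfolding P_def F_def by (rule sum_affine_alternating_product)
  ultimately show ?thesis
    unfolding eq by (simp add: a_def b_def s_def t_def)
qed

section \<open>Entries of the two circulant matrices\<close>

text \<open>The exceptional first entry \<open>(1 - 2 m) / (2 m)\<close> is the alternating value
  \<open>1 / (2 m)\<close> lowered by 1, which later separates the identity from a rank-one
  matrix.\<close>

lemma y_vec_entry:
  assumes "m > 0" "d < 2 * m"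
  shows "y_vec (Suc (2 * m)) $ d = (-1) ^ d / (2 * real m) - (if d = 0 then 1 else 0)"
  using assms by (simp add: y_vec_def field_simps)

text \<open>Makes \<open>alpha m d\<close> the right value also in the reversed second half of the
  list in \<open>x_vec\<close>.\<close>

lemma alpha_reflect:
  assumes "k \<le> 2 * m"
  shows "alpha m (2 * m - k) = alpha m k"
proof -
  have "(-1 :: real) ^ (2 * m - k) = (-1) ^ k"
    using assms by (simp add: minus_one_power_iff)
  then show ?thesis
    using assms by (simp add: alpha_def of_nat_diff power2_commute)
qed

text \<open>At \<open>d = 0\<close> the scaled \<open>alpha m d\<close> falls short of the first entry of the vector by exactly 1.\<close>

lemma x_vec_entry:
  assumes "m > 0" "d < 2 * m"
  shows "x_vec (Suc (2 * m)) $ d = alpha m d / (12 * real m) + (if d = 0 then 1 else 0)"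
proof -
  define xs where "xs = map (alpha m) [1..<m] @ [alpha m m] @ rev (map (alpha m) [1..<m])"
  have xs: "xs ! (d - 1) = alpha m d" if "d \<noteq> 0"
  proof -
    consider "d < m" | "d = m" | "m < d"
      by linarith
    then show ?thesis
    proof cases
      case 3
      then have "xs ! (d - 1) = alpha m (2 * m - d)"
        using assms by (simp add: xs_def nth_append rev_nth nth_Cons')
          (auto simp: mult_2 intro!: arg_cong[where f = "alpha m"])
      then show ?thesis
        using assms alpha_reflect[of d m] by simp
    qed (use that in \<open>auto simp: xs_def nth_append\<close>)
  qed
  have len: "length xs = 2 * m - 1"
    using assms by (simp add: xs_def)
  have "x_vec (Suc (2 * m)) = (1 / (12 * real m)) \<cdot>\<^sub>v
      vec_of_list ((4 * (real m)\<^sup>2 + 12 * real m - 7) # xs)"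
    by (simp add: x_vec_def xs_def power2_eq_square algebra_simps)
  then have "x_vec (Suc (2 * m)) $ d =
      ((4 * (real m)\<^sup>2 + 12 * real m - 7) # xs) ! d / (12 * real m)"
    using assms len by (simp add: vec_of_list_index del: vec_of_list_Cons)
  then show ?thesis
    using assms xs
    by (auto simp: nth_Cons' alpha_def field_simps)
qed

lemma dim_x_vec: "m > 0 \<Longrightarrow> dim_vec (x_vec (Suc (2 * m))) = 2 * m"
  by (simp add: x_vec_def)

lemma dim_y_vec: "dim_vec (y_vec (Suc (2 * m))) = 2 * m"
  by (simp add: y_vec_def)

lemma dim_circ: "dim_row (circ a) = dim_vec a" "dim_col (circ a) = dim_vec a"
  by (simp_all add: circ_def Let_def)

lemma cyclic_diff:
  fixes i j N :: nat
  assumes "i < N" "j < N"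
  shows "(j + N - i) mod N = (if i \<le> j then j - i else j + N - i)"
  using assms by (auto simp: mod_if)

lemma circ_y_entry:
  assumes "m > 0" "i < 2 * m" "j < 2 * m"
  shows "circ (y_vec (Suc (2 * m))) $$ (i, j) =
    (-1) ^ i * (-1) ^ j / (2 * real m) - (if i = j then 1 else 0)"
proof -
  \<comment> \<open>Reduction modulo the even order \<open>2 * m\<close> preserves parity, so the
    sign splits into a row sign and a column sign.\<close>
  have "(-1 :: real) ^ ((j + 2 * m - i) mod (2 * m)) = (-1) ^ i * (-1) ^ j"
    unfolding cyclic_diff[OF assms(2,3)] using assms by (simp add: minus_one_power_iff)
  moreover have "(j + 2 * m - i) mod (2 * m) = 0 \<longleftrightarrow> i = j"
    unfolding cyclic_diff[OF assms(2,3)] using assms by auto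
  ultimately show ?thesis
    using assms by (simp add: circ_def dim_y_vec y_vec_entry Let_def)
qed

lemma circ_x_entry:
  assumes "m > 0" "i < 2 * m" "j < 2 * m"
  shows "circ (x_vec (Suc (2 * m))) $$ (i, j) =
    - ((-1) ^ i * (-1) ^ j) * (2 * (real m)\<^sup>2 - 6 * (real m - \<bar>real j - real i\<bar>)\<^sup>2 + 7)
      / (12 * real m) + (if i = j then 1 else 0)"
proof -
  let ?d = "(j + 2 * m - i) mod (2 * m)"
  have "(-1 :: real) ^ ?d = (-1) ^ i * (-1) ^ j"
    unfolding cyclic_diff[OF assms(2,3)] using assms by (simp add: minus_one_power_iff)
  moreover have "?d = 0 \<longleftrightarrow> i = j"
    unfolding cyclic_diff[OF assms(2,3)] using assms by auto
  \<comment> \<open>For \<open>j < i\<close> the offset is \<open>2 m - (i - j)\<close>, and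
    \<open>(m - d)^2\<close> is invariant under \<open>d\<close> to \<open>2 m - d\<close>.\<close>
  moreover have "(real m - real ?d)\<^sup>2 = (real m - \<bar>real j - real i\<bar>)\<^sup>2"
    unfolding cyclic_diff[OF assms(2,3)] using assms
    by (auto simp: of_nat_diff power2_eq_square algebra_simps)
  ultimately show ?thesis
    using assms by (simp add: circ_def dim_x_vec x_vec_entry Let_def alpha_def)
qed

section \<open>Gram identities for the circulants\<close>

text \<open>The circulant \<open>B\<close> is \<open>P - I\<close> with \<open>P\<close> the
  orthogonal projection onto the alternating vector, so \<open>B' B = I - P = - B\<close>.\<close>

lemma sum_circ_y_product:
  assumes "m > 0" "i < 2 * m" "j < 2 * m"
  shows "(\<Sum>k<2 * m. circ (y_vec (Suc (2 * m))) $$ (k, i) * circ (y_vec (Suc (2 * m))) $$ (k, j)) =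
    - circ (y_vec (Suc (2 * m))) $$ (i, j)"
proof -
  \<comment> \<open>The product of two entries of \<open>P - I\<close> is expanded into the
    \<open>P\<close> part, two cross terms and the diagonal, so that each indicator sum
    collapses.\<close>
  have "(\<Sum>k<2 * m. circ (y_vec (Suc (2 * m))) $$ (k, i) * circ (y_vec (Suc (2 * m))) $$ (k, j)) =
    (\<Sum>k<2 * m. (-1) ^ i * (-1) ^ j / (2 * real m)\<^sup>2
       - (if k = i then (-1) ^ i * (-1) ^ j / (2 * real m) else 0)
       - (if k = j then (-1) ^ i * (-1) ^ j / (2 * real m) else 0)
       + (if k = i then (if i = j then 1 else 0) else 0))"
    using assms
    by (intro sum.cong refl, simp add: circ_y_entry)
       (auto simp: algebra_simps diff_divide_distrib power2_eq_square power_mult_distrib[symmetric])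
  also have "\<dots> = - circ (y_vec (Suc (2 * m))) $$ (i, j)"
    using assms
    by (simp add: sum.distrib sum_subtractf circ_y_entry) (simp add: power2_eq_square)
  finally show ?thesis .
qed

text \<open>Realizes the remainder \<open>C\<close> as a scaled Gram matrix. Adding \<open>B\<close>
  to \<open>A\<close> cancels the diagonal corrections and turns the constant 7 of
  \<open>alpha\<close> into the 1 of the correlation; the term \<open>- 3 * s\<close> there,
  multiplied by the sign \<open>s\<close>, becomes the constant \<open>- 1 / (4 m)\<close>.\<close>

lemma sum_signed_sawtooth_product:
  assumes "m > 0" "i < 2 * m" "j < 2 * m"
  shows "(\<Sum>k<2 * m. ((-1) ^ i * sawtooth m i k) * ((-1) ^ j * sawtooth m j k)) / (2 * (real m)\<^sup>2) =
    circ (x_vec (Suc (2 * m))) $$ (i, j) + circ (y_vec (Suc (2 * m))) $$ (i, j) - 1 / (4 * real m)"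
proof -
  define s :: real where "s = (-1) ^ i * (-1) ^ j"
  have s: "s * s = 1"
    by (simp add: s_def power_mult_distrib[symmetric] algebra_simps)
  have corr: "(\<Sum>k<2 * m. sawtooth m i k * sawtooth m j k) =
    real m / 6 * (6 * (real m - \<bar>real j - real i\<bar>)\<^sup>2 - 2 * (real m)\<^sup>2 - 1 - 3 * s)"
  proof (cases "i \<le> j")
    case True
    then show ?thesis
      using sawtooth_correlation[OF True assms(3)] by (simp add: s_def)
  next
    case False
    then have "j \<le> i"
      by simp
    from sawtooth_correlation[OF this assms(2)] show ?thesis
      using False by (simp add: s_def mult.commute)
  qed
  have "(\<Sum>k<2 * m. ((-1) ^ i * sawtooth m i k) * ((-1) ^ j * sawtooth m j k))
      = s * (\<Sum>k<2 * m. sawtooth m i k * sawtooth m j k)"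
    by (simp add: s_def sum_distrib_left mult_ac)
  also have "\<dots> / (2 * (real m)\<^sup>2)
      = (s * (6 * (real m - \<bar>real j - real i\<bar>)\<^sup>2 - 2 * (real m)\<^sup>2 - 1) - 3 * (s * s)) / (12 * real m)"
    unfolding corr using assms(1) by (simp add: field_simps power2_eq_square)
  also have "\<dots> = circ (x_vec (Suc (2 * m))) $$ (i, j) + circ (y_vec (Suc (2 * m))) $$ (i, j)
      - 1 / (4 * real m)"
    unfolding circ_x_entry[OF assms] circ_y_entry[OF assms] s_def[symmetric] s
    using assms(1) by (simp add: field_simps)
  finally show ?thesis .
qed

section \<open>Block entries of \<open>L\<close> and its splitting into three Gram matrices\<close>

lemma L_mat_entry:
  assumes m: "m > 0" and ij: "i < 4 * m + 1" "j < 4 * m + 1"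
  shows "L_mat (Suc (2 * m)) $$ (i, j) =
    (if i = 0 then if j = 0 then real m else if j \<le> 2 * m then - 1 / 2 else 0
     else if j = 0 then if i \<le> 2 * m then - 1 / 2 else 0
     else if i \<le> 2 * m then
       if j \<le> 2 * m then circ (x_vec (Suc (2 * m))) $$ (i - 1, j - 1)
       else circ (y_vec (Suc (2 * m))) $$ (i - 1, j - 1 - 2 * m)
     else if j \<le> 2 * m then circ (y_vec (Suc (2 * m))) $$ (i - 1 - 2 * m, j - 1)
     else if i = j then 1 else 0)"
proof -
  define N where "N = 2 * m"
  define A B where "A = circ (x_vec (Suc N))" and "B = circ (y_vec (Suc N))"
  define v where "v = ((- 1 / 2) \<cdot>\<^sub>v vec N (\<lambda>_. 1 :: real)) @\<^sub>v 0\<^sub>v N"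
  have dims: "dim_row A = N" "dim_col A = N" "dim_row B = N" "dim_col B = N" "dim_vec v = 2 * N"
    using m by (simp_all add: A_def B_def dim_circ N_def v_def dim_x_vec dim_y_vec)
  have v: "v $ k = (if k < N then - 1 / 2 else 0)" if "k < 2 * N" for k
    using that by (simp add: v_def)
  have "L_mat (Suc N) = four_block_mat (mat 1 1 (\<lambda>_. real m)) (mat_of_rows (2 * N) [v])
      (mat_of_cols (2 * N) [v]) (four_block_mat A B B (1\<^sub>m N))"
    unfolding L_mat_def Let_def A_def[symmetric] B_def[symmetric] by (simp add: v_def N_def)
  then have "L_mat (Suc N) $$ (i, j) =
    (if i = 0 then if j = 0 then real m else v $ (j - 1)
     else if j = 0 then v $ (i - 1) else four_block_mat A B B (1\<^sub>m N) $$ (i - 1, j - 1))"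
    using ij by (simp add: dims N_def mat_of_rows_def mat_of_cols_def)
  also have "\<dots> = (if i = 0 then if j = 0 then real m else if j \<le> N then - 1 / 2 else 0
     else if j = 0 then if i \<le> N then - 1 / 2 else 0
     else if i \<le> N then if j \<le> N then A $$ (i - 1, j - 1) else B $$ (i - 1, j - 1 - N)
     else if j \<le> N then B $$ (i - 1 - N, j - 1) else if i = j then 1 else 0)"
    using ij by (auto simp: dims v N_def)
  finally show ?thesis
    by (simp only: A_def B_def N_def)
qed

theorem theorem4p21:
  fixes n :: nat
  assumes "n \<ge> 5" and "odd n"
  shows "pos_semidef (L_mat n)"
proof -
  obtain m where n: "n = Suc (2 * m)"
    using assms(2) by (auto elim: oddE)
  have m: "m > 0"
    using assms(1) n by simp
  define N where "N = 2 * m"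
  define A B where "A = circ (x_vec n)" and "B = circ (y_vec n)"
  \<comment> \<open>Coefficients of \<open>t - e'u / (2 m)\<close> in the coordinates
    \<open>(t, u, w)\<close>: index 0 is \<open>t\<close>, indices 1 to \<open>N\<close> are
    \<open>u\<close>, the rest are \<open>w\<close>. The one-point type indexes this single
    square.\<close>
  define p :: "unit \<Rightarrow> nat \<Rightarrow> real"
    where "p u i = (if i = 0 then 1 else if i \<le> N then - 1 / real N else 0)" for u i
  \<comment> \<open>Row \<open>k\<close> is the \<open>k\<close>-th coordinate of
    \<open>B u + w\<close>.\<close>
  define q where "q k i = (if i = 0 then 0 else if i \<le> N then B $$ (k, i - 1)
    else if i - 1 - N = k then 1 else 0)" for k i
  \<comment> \<open>Row \<open>k\<close> collects the values at \<open>k\<close> of the signed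
    sawtooth shifts and acts on \<open>u\<close> alone; it yields \<open>C\<close>.\<close>
  define h where "h k i = (if i = 0 \<or> i > N then 0 else (-1) ^ (i - 1) * sawtooth m (i - 1) k)"
    for k i
  let ?d = "2 * N + 1"
  let ?P = "real m \<cdot>\<^sub>m gram_mat UNIV ?d p" and ?Q = "gram_mat {..<N} ?d q"
    and ?H = "(1 / (2 * (real m)\<^sup>2)) \<cdot>\<^sub>m gram_mat {..<N} ?d h"
  have BB: "(\<Sum>k<N. B $$ (k, i) * B $$ (k, j)) = - B $$ (i, j)" if "i < N" "j < N" for i j
    using sum_circ_y_product[OF m] that by (simp add: B_def n N_def)
  have HH: "(\<Sum>k<N. ((-1) ^ i * sawtooth m i k) * ((-1) ^ j * sawtooth m j k)) / (2 * (real m)\<^sup>2)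
      = A $$ (i, j) + B $$ (i, j) - 1 / (4 * real m)" if "i < N" "j < N" for i j
    using sum_signed_sawtooth_product[OF m] that by (simp add: A_def B_def n N_def)
  have Bsym: "B $$ (i, j) = B $$ (j, i)" if "i < N" "j < N" for i j
    using circ_y_entry[OF m] that by (simp add: B_def n N_def mult.commute)
  have "L_mat n = ?P + ?Q + ?H"
  proof (rule eq_matI)
    fix i j
    assume "i < dim_row (?P + ?Q + ?H)" "j < dim_col (?P + ?Q + ?H)"
    then have ij: "i < ?d" "j < ?d"
      by (simp_all add: gram_mat_def)
    define c where "c = (\<Sum>k<N. h k i * h k j) / (2 * (real m)\<^sup>2)"
    have rhs: "(?P + ?Q + ?H) $$ (i, j) = real m * (p () i * p () j) + (\<Sum>k<N. q k i * q k j) + c"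
      using ij by (simp add: gram_mat_def c_def UNIV_unit)
    have L: "L_mat n $$ (i, j) =
      (if i = 0 then if j = 0 then real m else if j \<le> N then - 1 / 2 else 0
       else if j = 0 then if i \<le> N then - 1 / 2 else 0
       else if i \<le> N then if j \<le> N then A $$ (i - 1, j - 1) else B $$ (i - 1, j - 1 - N)
       else if j \<le> N then B $$ (i - 1 - N, j - 1) else if i = j then 1 else 0)"
      using L_mat_entry[OF m, of i j] ij unfolding A_def B_def N_def n by simp
    consider "i = 0" | "j = 0" | "0 < i" "i \<le> N" "0 < j" "j \<le> N" | "0 < i" "i \<le> N" "N < j"
      | "N < i" "0 < j" "j \<le> N" | "N < i" "N < j"
      by linarith
    then show "L_mat n $$ (i, j) = (?P + ?Q + ?H) $$ (i, j)"
    proof cases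
      case 1
      then show ?thesis
        unfolding L rhs c_def using m by (simp add: p_def q_def h_def N_def)
    next
      case 2
      then show ?thesis
        unfolding L rhs c_def using m by (simp add: p_def q_def h_def N_def)
    next
      \<comment> \<open>In the \<open>A\<close> block the contributions are
        \<open>1 / (4 m)\<close>, \<open>- B\<close> and \<open>A + B - 1 / (4 m)\<close>.\<close>
      case 3
      then have "i - 1 < N" "j - 1 < N"
        by auto
      note this[simp]
      have "c = A $$ (i - 1, j - 1) + B $$ (i - 1, j - 1) - 1 / (4 * real m)"
        unfolding c_def using 3 by (simp add: h_def HH[symmetric])
      moreover have "(\<Sum>k<N. q k i * q k j) = - B $$ (i - 1, j - 1)"
        using 3 by (simp add: q_def BB[symmetric])
      moreover have "real m * (p () i * p () j) = 1 / (4 * real m)"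
        using 3 m by (simp add: p_def N_def)
      ultimately show ?thesis
        unfolding L rhs using 3 by simp
    next
      \<comment> \<open>Only \<open>q\<close> contributes, and its indicator selects the transposed
        entry of \<open>B\<close>, hence the appeal to symmetry.\<close>
      case 4
      then have "j - 1 - N < N" "i - 1 < N"
        using ij by auto
      then show ?thesis
        unfolding L rhs c_def using 4 Bsym[of "i - 1" "j - 1 - N"]
        by (simp add: p_def q_def h_def if_distrib[where f = "\<lambda>x. _ * x"] cong: if_cong)
    next
      case 5
      then have "i - 1 - N < N"
        using ij by auto
      then show ?thesis
        unfolding L rhs c_def using 5
        by (simp add: p_def q_def h_def if_distrib[where f = "\<lambda>x. x * _"] cong: if_cong)
    next
      case 6
      then have "i - 1 - N < N" "j - 1 - N < N" "j - 1 - N = i - 1 - N \<longleftrightarrow> i = j"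
        using ij by auto
      then show ?thesis
        unfolding L rhs c_def using 6
        by (simp add: p_def q_def h_def if_distrib[where f = "\<lambda>x. x * _"] cong: if_cong)
    qed
  qed (use m in \<open>simp_all add: gram_mat_def L_mat_def Let_def dim_circ n N_def dim_x_vec\<close>)
  moreover have "pos_semidef (?P + ?Q + ?H)"
    by (intro pos_semidef_add[where d = ?d] pos_semidef_smult[where d = ?d] pos_semidef_gram_mat)
       (simp_all add: gram_mat_carrier)
  ultimately show ?thesis
    by simp
qed

end
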